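(* $\mathrm{coRE}\cap\mathrm{F_{REC}}\text{-rankable} = \mathrm{coRE}\cap\mathrm{F_{PR}}\text{-rankable}$.
   Context: $\Sigma=\{0,1\}$, with $\Sigma^\ast$ ordered by length then lexicographically. $\mathrm{coRE}$ is the class of sets $A\subseteq\Sigma^\ast$ whose complement is recursively enumerable. $\mathrm{F_{REC}}$ ($\mathrm{F_{PR}}$) is the class of total (partial) recursive functions $\Sigma^\ast\to\Sigma^\ast$. A (possibly partial) function $f$ is a ranking function for $A$ if $f$ is defined on all of $A$ and for every $x\in A$, if $x$ is the $i$th element of $A$ then $f(x)$ is the $i$th string of $\Sigma^\ast$ (no condition outside $A$). For a function class $\mathcal{F}$, $\mathcal{F}$-rankable is the class of sets with a ranking function in $\mathcal{F}$. *)

theory Defs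
  imports "HOL-Library.List_Lenlexorder"
begin

text \<open>
  Strings over $\{0,1\}$ are modelled as \<^typ>\<open>bool list\<close>, with \<^const>\<open>False\<close> for 0 and
  \<^const>\<open>True\<close> for 1. The imported order instance makes \<open>\<le>\<close> on \<^typ>\<open>bool list\<close> the
  length-lexicographic order.
\<close>

type_synonym word = "bool list"

definition minimize :: "(nat \<Rightarrow> nat option) \<Rightarrow> nat option" where
  "minimize f =
     (let P = (\<lambda>n. f n = Some 0 \<and> (\<forall>m<n. \<exists>y>0. f m = Some y))
      in if \<exists>n. P n then Some (LEAST n. P n) else None)"

text \<open>
  \<open>partrec_nat k f\<close>: on argument lists of length \<open>k\<close>, \<open>f\<close> is a \<open>k\<close>-ary partial recursive
  function in the sense of Kleene. The values of \<open>f\<close> on lists of any other length are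
  irrelevant. Composition is strict: the result is undefined as soon as one inner
  function is undefined.
\<close>

inductive partrec_nat :: "nat \<Rightarrow> (nat list \<Rightarrow> nat option) \<Rightarrow> bool" where
  zero: "partrec_nat k (\<lambda>_. Some 0)"
| succ: "partrec_nat 1 (\<lambda>xs. Some (Suc (hd xs)))"
| proj: "i < k \<Longrightarrow> partrec_nat k (\<lambda>xs. Some (xs ! i))"
| comp: "partrec_nat (length hs) g \<Longrightarrow> (\<And>h. h \<in> set hs \<Longrightarrow> partrec_nat k h) \<Longrightarrow>
    partrec_nat k
      (\<lambda>xs. if \<forall>h\<in>set hs. h xs \<noteq> None then g (map (\<lambda>h. the (h xs)) hs) else None)"
| prim_rec: "partrec_nat k g \<Longrightarrow> partrec_nat (Suc (Suc k)) h \<Longrightarrow>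
    partrec_nat (Suc k)
      (\<lambda>xs. rec_nat (g (tl xs)) (\<lambda>n r. Option.bind r (\<lambda>y. h (n # y # tl xs))) (hd xs))"
| minim: "partrec_nat (Suc k) g \<Longrightarrow> partrec_nat k (\<lambda>xs. minimize (\<lambda>n. g (n # xs)))"

text \<open>
  Computability is transferred to strings along the standard identification of a string
  with its position in the length-lexicographic order (bijective base 2 with digits 1, 2,
  most significant digit first).
\<close>

primrec word_code :: "word \<Rightarrow> nat" where
  "word_code [] = 0"
| "word_code (b # w) = (if b then 2 else 1) * 2 ^ length w + word_code w"

lemma word_code_bounds: "2 ^ length w \<le> Suc (word_code w)" "Suc (word_code w) < 2 * 2 ^ length w"
  by (induction w) auto

lemma word_code_less: "v < w \<Longrightarrow> word_code v < word_code w"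
proof (induction v arbitrary: w)
  case Nil
  then show ?case by (cases w) (auto simp: list_less_def)
next
  case (Cons a v)
  then obtain b u where w: "w = b # u" by (cases w) auto
  consider "length v < length u" | "length v = length u" "a < b"
    | "length v = length u" "a = b" "v < u"
    using Cons.prems by (auto simp: w Cons_less_Cons)
  then show ?case
  proof cases
    case 1
    then have "(2::nat) ^ length (a # v) * 2 \<le> 2 ^ length (b # u) "
      by (metis Suc_leI length_Cons power_increasing power_Suc2 one_le_numeral Suc_less_eq)
    with word_code_bounds[of "a # v"] word_code_bounds[of "b # u"] show ?thesis
      unfolding w by linarith
  next
    case 2
    with word_code_bounds[of v] word_code_bounds[of u] show ?thesis by (auto simp: w)
  next
    case 3
    with Cons.IH show ?thesis by (simp add: w)
  qed
qed

lemma word_code_strict_mono: "strict_mono word_code"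
  by (simp add: strict_mono_def word_code_less)

lemma word_code_snoc: "word_code (w @ [b]) = 2 * word_code w + (if b then 2 else 1)"
  by (induction w) (auto simp: algebra_simps)

lemma word_code_surj: "\<exists>w. word_code w = n"
proof (induction n rule: less_induct)
  case (less n)
  show ?case
  proof (cases n)
    case 0
    then show ?thesis by (intro exI[of _ "[]"]) simp
  next
    case (Suc m)
    have "m div 2 < n" by (simp add: Suc le_imp_less_Suc)
    then obtain w where w: "word_code w = m div 2" using less by blast
    have "word_code (w @ [odd m]) = n"
      unfolding word_code_snoc w Suc by (cases "even m") (auto elim!: evenE oddE)
    then show ?thesis by blast
  qed
qed

lemma word_code_bij: "bij word_code"
  using strict_mono_imp_inj_on[OF word_code_strict_mono] word_code_surj
  by (auto simp: bij_def surj_def) metis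

lemma finite_initial_segment: "finite {y::word. y \<le> x}"
proof (rule finite_imageD)
  show "finite (word_code ` {y. y \<le> x})"
    by (rule finite_subset[of _ "{..word_code x}"])
       (auto simp: strict_mono_less_eq[OF word_code_strict_mono])
  show "inj_on word_code {y. y \<le> x}"
    using word_code_bij by (auto simp: bij_def intro: inj_on_subset)
qed

definition F_PR :: "(word \<Rightarrow> word option) set" where
  "F_PR = {f. \<exists>g. partrec_nat 1 g \<and> (\<forall>w. g [word_code w] = map_option word_code (f w))}"

definition F_REC :: "(word \<Rightarrow> word option) set" where
  "F_REC = {f \<in> F_PR. dom f = UNIV}"

definition RE :: "word set set" where
  "RE = {A. \<exists>f\<in>F_PR. A = dom f}"

definition coRE :: "word set set" where
  "coRE = {A. - A \<in> RE}"

text \<open>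
  Indices start at 1. The cardinality is meaningful because initial segments are finite
  (\<open>finite_initial_segment\<close>).
\<close>

definition is_ith :: "word set \<Rightarrow> nat \<Rightarrow> word \<Rightarrow> bool" where
  "is_ith A i x \<longleftrightarrow> x \<in> A \<and> card {y \<in> A. y \<le> x} = i"

definition ranking_function :: "(word \<Rightarrow> word option) \<Rightarrow> word set \<Rightarrow> bool" where
  "ranking_function f A \<longleftrightarrow>
     A \<subseteq> dom f \<and> (\<forall>x\<in>A. \<forall>i. is_ith A i x \<longrightarrow> is_ith UNIV i (the (f x)))"

definition rankable :: "(word \<Rightarrow> word option) set \<Rightarrow> word set set" where
  "rankable F = {A. \<exists>f\<in>F. ranking_function f A}"

end

theory Submission
  imports Defs
begin

text \<open>
  Let \<open>f\<close> be a partial recursive ranking function for \<open>A\<close> and let \<open>e\<close> be a partial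
  recursive function with domain \<open>- A\<close>. Run \<open>f\<close> and \<open>e\<close> in parallel on \<open>x\<close>: at least one
  of them halts. Output the value of \<open>f\<close> if it is available at that moment, and an arbitrary
  string otherwise. For \<open>x \<in> A\<close> the computation of \<open>e\<close> never halts, so the value is \<open>f x\<close>.

  Parallel simulation needs no universal machine: by induction on the definition of \<open>f\<close>
  there is a total recursive stage function \<open>F (x, s)\<close> that is \<open>0\<close> as long as the value is
  not known at stage \<open>s\<close>, and \<open>Suc (f x)\<close> for all large \<open>s\<close> if \<open>f x\<close> is defined.
\<close>

section \<open>Total recursive functions\<close>

text \<open>
  \<^const>\<open>partrec_nat\<close> is sensitive to the values on argument lists of the wrong length;
  the following notion is not.
\<close>

definition total_rec :: "nat \<Rightarrow> (nat list \<Rightarrow> nat) \<Rightarrow> bool" where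
  "total_rec k F \<longleftrightarrow> (\<exists>g. partrec_nat k g \<and> (\<forall>xs. length xs = k \<longrightarrow> g xs = Some (F xs)))"

lemma total_rec_cong:
  assumes "total_rec k F" and "\<And>xs. length xs = k \<Longrightarrow> F xs = G xs"
  shows "total_rec k G"
  using assms unfolding total_rec_def by metis

lemma total_rec_zero: "total_rec k (\<lambda>_. 0)"
  unfolding total_rec_def by (blast intro: partrec_nat.zero)

lemma total_rec_proj: "i < k \<Longrightarrow> total_rec k (\<lambda>xs. xs ! i)"
  unfolding total_rec_def by (blast intro: partrec_nat.proj)

lemma total_rec_comp:
  assumes "total_rec (length Hs) G" and "\<And>H. H \<in> set Hs \<Longrightarrow> total_rec k H"
  shows "total_rec k (\<lambda>xs. G (map (\<lambda>H. H xs) Hs))"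
proof -
  obtain g where g: "partrec_nat (length Hs) g"
      "\<And>xs. length xs = length Hs \<Longrightarrow> g xs = Some (G xs)"
    using assms(1) unfolding total_rec_def by blast
  obtain c where c: "\<And>H. H \<in> set Hs \<Longrightarrow> partrec_nat k (c H)"
      "\<And>H xs. H \<in> set Hs \<Longrightarrow> length xs = k \<Longrightarrow> c H xs = Some (H xs)"
    using assms(2) unfolding total_rec_def by metis
  define hs where "hs = map c Hs"
  have "partrec_nat k
      (\<lambda>xs. if \<forall>h\<in>set hs. h xs \<noteq> None then g (map (\<lambda>h. the (h xs)) hs) else None)"
    by (rule partrec_nat.comp) (use g(1) c(1) in \<open>auto simp: hs_def\<close>)
  moreover have "map (\<lambda>h. the (h xs)) hs = map (\<lambda>H. H xs) Hs"
      "\<forall>h\<in>set hs. h xs \<noteq> None" if "length xs = k" for xs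
    using c(2) that by (auto simp: hs_def)
  ultimately show ?thesis
    unfolding total_rec_def using g(2) by (intro exI conjI) auto
qed

lemma total_rec_comp1:
  assumes "total_rec 1 G" "total_rec k H"
  shows "total_rec k (\<lambda>xs. G [H xs])"
  using total_rec_comp[of "[H]" G k] assms by simp

lemma total_rec_comp2:
  assumes "total_rec 2 G" "total_rec k H1" "total_rec k H2"
  shows "total_rec k (\<lambda>xs. G [H1 xs, H2 xs])"
  using total_rec_comp[of "[H1, H2]" G k] assms by (auto simp: numeral_2_eq_2)

lemma total_rec_Suc: "total_rec k H \<Longrightarrow> total_rec k (\<lambda>xs. Suc (H xs))"
proof -
  have "total_rec 1 (\<lambda>xs. Suc (hd xs))"
    unfolding total_rec_def by (blast intro: partrec_nat.succ)
  then show "total_rec k H \<Longrightarrow> ?thesis" using total_rec_comp1 by fastforce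
qed

lemma total_rec_prim_rec:
  assumes "total_rec k G" "total_rec (Suc (Suc k)) H"
  shows "total_rec (Suc k)
    (\<lambda>xs. rec_nat (G (tl xs)) (\<lambda>n r. H (n # r # tl xs)) (hd xs))"
proof -
  obtain g where g: "partrec_nat k g" "\<And>xs. length xs = k \<Longrightarrow> g xs = Some (G xs)"
    using assms(1) unfolding total_rec_def by blast
  obtain h where h: "partrec_nat (Suc (Suc k)) h"
      "\<And>xs. length xs = Suc (Suc k) \<Longrightarrow> h xs = Some (H xs)"
    using assms(2) unfolding total_rec_def by blast
  have "rec_nat (g (tl xs)) (\<lambda>n r. Option.bind r (\<lambda>y. h (n # y # tl xs))) m =
      Some (rec_nat (G (tl xs)) (\<lambda>n r. H (n # r # tl xs)) m)" if "length xs = Suc k" for xs m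
    by (induction m) (use that g(2) h(2) in auto)
  then show ?thesis
    unfolding total_rec_def using partrec_nat.prim_rec[OF g(1) h(1)] by blast
qed

section \<open>Unbounded search and elementary arithmetic\<close>

text \<open>At most one \<open>n\<close> can qualify: of two candidates, the smaller would have a
  value both zero and positive. So \<open>LEAST\<close> returns any candidate that exists.\<close>

lemma minimize_eq_Some_iff:
  "minimize f = Some n \<longleftrightarrow> f n = Some 0 \<and> (\<forall>m<n. \<exists>y>0. f m = Some y)"
proof -
  define P where "P n \<longleftrightarrow> f n = Some 0 \<and> (\<forall>m<n. \<exists>y>0. f m = Some y)" for n
  have unique: "a = b" if "P a" "P b" for a b
    using that unfolding P_def by (metis less_irrefl linorder_less_linear option.inject)
  have "minimize f = (if \<exists>n. P n then Some (LEAST n. P n) else None)"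
    by (simp add: minimize_def P_def Let_def)
  then have "minimize f = Some n \<longleftrightarrow> P n"
    using unique by (metis LeastI_ex option.distinct(1) option.inject)
  then show ?thesis by (simp add: P_def)
qed

text \<open>The guaranteed zero keeps minimization total. This is how later proofs search for a
  stopping index or a stage.\<close>

lemma total_rec_Least:
  assumes "total_rec (Suc k) G" and ex: "\<And>xs. length xs = k \<Longrightarrow> \<exists>n. G (n # xs) = 0"
  shows "total_rec k (\<lambda>xs. LEAST n. G (n # xs) = 0)"
proof -
  obtain g where g: "partrec_nat (Suc k) g"
      "\<And>xs. length xs = Suc k \<Longrightarrow> g xs = Some (G xs)"
    using assms(1) unfolding total_rec_def by blast
  have "minimize (\<lambda>n. g (n # xs)) = Some (LEAST n. G (n # xs) = 0)" if "length xs = k" for xs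
    unfolding minimize_eq_Some_iff
    using that g(2) LeastI_ex[OF ex] by (auto dest: not_less_Least)
  then show ?thesis
    unfolding total_rec_def using partrec_nat.minim[OF g(1)] by blast
qed

text \<open>The recursion step returns its counter and ignores the previous value, which yields 0 at
  0 and \<open>n\<close> at \<open>Suc n\<close>.\<close>

lemma total_rec_pred:
  assumes "total_rec k H"
  shows "total_rec k (\<lambda>xs. H xs - 1)"
proof -
  have "total_rec 1 (\<lambda>xs. rec_nat 0 (\<lambda>n r. (n # r # tl xs) ! 0) (hd xs))"
    using total_rec_prim_rec[OF total_rec_zero[of 0] total_rec_proj[of 0]] by simp
  moreover have "rec_nat 0 (\<lambda>n r. n) m = m - 1" for m :: nat by (cases m) auto
  ultimately show ?thesis using total_rec_comp1[OF _ assms] by fastforce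
qed

text \<open>Iterates the predecessor. Recursion runs on the first argument, so the subtrahend is
  passed first.\<close>

lemma total_rec_diff:
  assumes "total_rec k H1" "total_rec k H2"
  shows "total_rec k (\<lambda>xs. H1 xs - H2 xs)"
proof -
  have "total_rec 2 (\<lambda>xs. rec_nat (tl xs ! 0) (\<lambda>n r. (n # r # tl xs) ! 1 - 1) (hd xs))"
    using total_rec_prim_rec[OF total_rec_proj[of 0 1] total_rec_pred[OF total_rec_proj[of 1]]]
    by (simp add: numeral_2_eq_2)
  moreover have "rec_nat a (\<lambda>n r. r - 1) m = a - m" for a m :: nat by (induction m) auto
  ultimately show ?thesis using total_rec_comp2[OF _ assms(2,1)] by fastforce
qed

text \<open>Recursion on the value of \<open>C\<close>: the base case is \<open>A\<close>, and every
  step discards the previous result and returns \<open>B\<close>, which sits at index 3 behind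
  counter, previous result and \<open>A\<close>.\<close>

lemma total_rec_if:
  assumes "total_rec k C" "total_rec k A" "total_rec k B"
  shows "total_rec k (\<lambda>xs. if C xs = 0 then A xs else B xs)"
proof -
  have "total_rec 3 (\<lambda>xs. rec_nat (tl xs ! 0) (\<lambda>n r. (n # r # tl xs) ! 3) (hd xs))"
    using total_rec_prim_rec[OF total_rec_proj[of 0 2] total_rec_proj[of 3]]
    by (simp add: numeral_3_eq_3 numeral_2_eq_2)
  then have "total_rec k (\<lambda>xs. rec_nat (A xs) (\<lambda>n r. B xs) (C xs))"
    using total_rec_comp[of "[C, A, B]" _ k] assms by (fastforce simp: numeral_3_eq_3)
  moreover have "rec_nat a (\<lambda>n r. b) m = (if m = 0 then a else b)" for a b m :: nat
    by (cases m) auto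
  ultimately show ?thesis by simp
qed

lemma total_rec_if_all:
  assumes "\<And>H. H \<in> set Hs \<Longrightarrow> total_rec k H" "total_rec k A"
  shows "total_rec k (\<lambda>xs. if \<forall>H\<in>set Hs. H xs \<noteq> 0 then A xs else 0)"
  using assms
proof (induction Hs)
  case (Cons H Hs)
  then have "total_rec k
      (\<lambda>xs. if H xs = 0 then 0 else if \<forall>H\<in>set Hs. H xs \<noteq> 0 then A xs else 0)"
    by (intro total_rec_if total_rec_zero) auto
  then show ?case by (rule total_rec_cong) auto
qed simp

section \<open>Stage functions\<close>

text \<open>
  The stage is the last argument, so that the leading argument remains the one on which
  primitive recursion and minimization operate.
\<close>

definition stages :: "nat \<Rightarrow> (nat list \<Rightarrow> nat option) \<Rightarrow> (nat list \<Rightarrow> nat) \<Rightarrow> bool" where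
  "stages k f F \<longleftrightarrow> total_rec (Suc k) F \<and>
     (\<forall>xs. length xs = k \<longrightarrow>
       (\<forall>s y. F (xs @ [s]) = Suc y \<longrightarrow> f xs = Some y) \<and>
       (\<forall>y. f xs = Some y \<longrightarrow> (\<forall>\<^sub>F s in sequentially. F (xs @ [s]) = Suc y)))"

lemma stagesI:
  assumes "total_rec (Suc k) F"
    and "\<And>xs s y. length xs = k \<Longrightarrow> F (xs @ [s]) = Suc y \<Longrightarrow> f xs = Some y"
    and "\<And>xs y. length xs = k \<Longrightarrow> f xs = Some y \<Longrightarrow>
      \<forall>\<^sub>F s in sequentially. F (xs @ [s]) = Suc y"
  shows "stages k f F"
  using assms unfolding stages_def by blast

lemma stages_total_rec: "stages k f F \<Longrightarrow> total_rec (Suc k) F"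
  and stages_sound: "stages k f F \<Longrightarrow> length xs = k \<Longrightarrow> F (xs @ [s]) = Suc y \<Longrightarrow> f xs = Some y"
  and stages_complete: "stages k f F \<Longrightarrow> length xs = k \<Longrightarrow> f xs = Some y \<Longrightarrow>
    \<forall>\<^sub>F s in sequentially. F (xs @ [s]) = Suc y"
  unfolding stages_def by blast+

section \<open>Closure of stage functions under the Kleene operations\<close>

text \<open>All inner functions and the outer one are run at the same stage. Requiring every inner
  value to be known mirrors strictness of composition.\<close>

lemma stages_comp:
  assumes g: "stages (length hs) g G" and h: "\<And>h. h \<in> set hs \<Longrightarrow> stages k h (c h)"
  shows "\<exists>F. stages k
    (\<lambda>xs. if \<forall>h\<in>set hs. h xs \<noteq> None then g (map (\<lambda>h. the (h xs)) hs) else None) F"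
    (is "\<exists>F. stages k ?f F")
proof -
  \<comment> \<open>\<open>ys ! k\<close> is the stage; subtracting 1 removes the \<open>Suc\<close>
    that marks a known value.\<close>
  define F where "F ys = (if \<forall>H\<in>set (map c hs). H ys \<noteq> 0
      then G (map (\<lambda>h. c h ys - 1) hs @ [ys ! k]) else 0)" for ys
  have F: "F (xs @ [s]) = (if \<forall>h\<in>set hs. c h (xs @ [s]) \<noteq> 0
      then G (map (\<lambda>h. c h (xs @ [s]) - 1) hs @ [s]) else 0)" if "length xs = k" for xs s
    using that by (auto simp: F_def nth_append)
  show ?thesis
  proof (rule exI, rule stagesI)
    have "total_rec (Suc k)
        (\<lambda>ys. G (map (\<lambda>H. H ys) (map (\<lambda>h ys. c h ys - 1) hs @ [\<lambda>ys. ys ! k])))"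
      by (rule total_rec_comp)
        (use stages_total_rec[OF g] h in \<open>auto intro: total_rec_pred[unfolded One_nat_def] total_rec_proj
            stages_total_rec\<close>)
    then show "total_rec (Suc k) F"
      unfolding F_def using h
      by (intro total_rec_if_all) (auto simp: comp_def dest: stages_total_rec)
  next
    fix xs s y
    assume xs: "length xs = k" and "F (xs @ [s]) = Suc y"
    then have nz: "\<forall>h\<in>set hs. c h (xs @ [s]) \<noteq> 0"
      and y: "G (map (\<lambda>h. c h (xs @ [s]) - 1) hs @ [s]) = Suc y"
      by (auto simp: F split: if_splits)
    have val: "h xs = Some (c h (xs @ [s]) - 1)" if "h \<in> set hs" for h
      using stages_sound[OF h[OF that] xs, of s] nz that by (cases "c h (xs @ [s])") auto
    have "?f xs = g (map (\<lambda>h. the (h xs)) hs)"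
      by (rule if_P) (use val in blast)
    moreover have "map (\<lambda>h. the (h xs)) hs = map (\<lambda>h. c h (xs @ [s]) - 1) hs"
      by (intro map_cong refl) (metis val option.sel)
    moreover have "g (map (\<lambda>h. c h (xs @ [s]) - 1) hs) = Some y"
      using stages_sound[OF g _ y] by simp
    ultimately show "?f xs = Some y" by metis
  next
    fix xs y
    assume xs: "length xs = k" and "?f xs = Some y"
    then have def: "\<forall>h\<in>set hs. h xs \<noteq> None" and y: "g (map (\<lambda>h. the (h xs)) hs) = Some y"
      by (auto split: if_splits)
    \<comment> \<open>Finitely many inner functions, so their eventual statements hold
      simultaneously.\<close>
    have "\<forall>\<^sub>F s in sequentially. \<forall>h\<in>set hs. c h (xs @ [s]) = Suc (the (h xs))"
      using def stages_complete[OF h xs] by (auto simp: eventually_ball_finite_distrib)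
    moreover have "\<forall>\<^sub>F s in sequentially. G (map (\<lambda>h. the (h xs)) hs @ [s]) = Suc y"
      using stages_complete[OF g _ y] by simp
    ultimately show "\<forall>\<^sub>F s in sequentially. F (xs @ [s]) = Suc y"
    proof eventually_elim
      case (elim s)
      have "map (\<lambda>h. c h (xs @ [s]) - 1) hs = map (\<lambda>h. the (h xs)) hs" using elim(1) by auto
      moreover have "\<forall>h\<in>set hs. c h (xs @ [s]) \<noteq> 0" using elim(1) by simp
      ultimately show ?case unfolding F[OF xs] using elim(2) by metis
    qed
  qed
qed

text \<open>Every step of the recursion uses the same stage, so \<open>F\<close> is itself a
  primitive recursion. For a fixed recursion depth only finitely many values must become
  known.\<close>

lemma stages_prim_rec:
  assumes g: "stages k g G" and h: "stages (Suc (Suc k)) h H"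
  shows "\<exists>F. stages (Suc k)
    (\<lambda>xs. rec_nat (g (tl xs)) (\<lambda>n r. Option.bind r (\<lambda>y. h (n # y # tl xs))) (hd xs)) F"
    (is "\<exists>F. stages (Suc k) ?f F")
proof -
  \<comment> \<open>An unknown previous value (0) stays unknown; a known one loses its
    \<open>Suc\<close> before it reaches \<open>H\<close>. The tail \<open>drop 2 ys\<close> holds
    the parameters and the stage.\<close>
  define H' where "H' ys = (if ys ! 1 = 0 then 0 else H (ys ! 0 # (ys ! 1 - 1) # drop 2 ys))" for ys
  define F where "F ys = rec_nat (G (tl ys)) (\<lambda>n r. H' (n # r # tl ys)) (hd ys)" for ys
  have F0: "F (0 # ys) = G ys" for ys
    by (simp add: F_def)
  have FS: "F (Suc n # ys) = (if F (n # ys) = 0 then 0 else H (n # (F (n # ys) - 1) # ys))" for n ys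
    by (simp add: F_def H'_def)
  have fS: "?f (Suc n # ys) = Option.bind (?f (n # ys)) (\<lambda>y. h (n # y # ys))" for n ys
    by simp
  show ?thesis
  proof (rule exI, rule stagesI)
    \<comment> \<open>Rebuilds the argument list of \<open>H\<close> from projections, so that
      composition applies.\<close>
    let ?Hs = "(\<lambda>ys. ys ! 0) # (\<lambda>ys. ys ! 1 - 1) # map (\<lambda>i ys. ys ! i) [2..<Suc (Suc (Suc k))]"
    have "total_rec (Suc (Suc (Suc k))) (\<lambda>ys. H (map (\<lambda>H. H ys) ?Hs))"
      by (rule total_rec_comp)
        (use stages_total_rec[OF h] in
          \<open>auto intro!: total_rec_pred[unfolded One_nat_def] total_rec_proj
            simp del: upt_Suc simp: Suc_diff_le\<close>)
    then have "total_rec (Suc (Suc (Suc k))) (\<lambda>ys. H (ys ! 0 # (ys ! 1 - 1) # drop 2 ys))"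
    proof (rule total_rec_cong)
      fix ys :: "nat list"
      assume "length ys = Suc (Suc (Suc k))"
      then have "map ((!) ys) [2..<Suc (Suc (Suc k))] = drop 2 ys"
        by (metis drop_map drop_upt map_nth add_0)
      then show "H (map (\<lambda>H. H ys) ?Hs) = H (ys ! 0 # (ys ! 1 - 1) # drop 2 ys)"
        by (simp add: comp_def del: upt_Suc)
    qed
    then have "total_rec (Suc (Suc (Suc k))) H'"
      unfolding H'_def by (intro total_rec_if total_rec_zero total_rec_proj) auto
    then show "total_rec (Suc (Suc k)) F"
      unfolding F_def by (rule total_rec_prim_rec[OF stages_total_rec[OF g]])
  next
    fix xs s y
    assume "length xs = Suc k" and F: "F (xs @ [s]) = Suc y"
    then obtain m zs where xs: "xs = m # zs" and zs: "length zs = k" by (auto simp: length_Suc_conv)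
    have "F (m # zs @ [s]) = Suc y \<Longrightarrow> ?f (m # zs) = Some y" for y
    proof (induction m arbitrary: y)
      case 0
      then show ?case using stages_sound[OF g zs] by (simp add: F0)
    next
      case (Suc m)
      then obtain r where r: "F (m # zs @ [s]) = Suc r"
        by (cases "F (m # zs @ [s])") (auto simp: FS)
      then have "H ((m # r # zs) @ [s]) = Suc y" using Suc.prems by (simp add: FS)
      then have "h (m # r # zs) = Some y" using stages_sound[OF h] zs by simp
      then show ?case using Suc.IH[OF r] unfolding fS by simp
    qed
    then show "?f xs = Some y" using F unfolding xs by simp
  next
    fix xs y
    assume "length xs = Suc k" and f: "?f xs = Some y"
    then obtain m zs where xs: "xs = m # zs" and zs: "length zs = k" by (auto simp: length_Suc_conv)
    have "?f (m # zs) = Some y \<Longrightarrow> \<forall>\<^sub>F s in sequentially. F (m # zs @ [s]) = Suc y" for y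
    proof (induction m arbitrary: y)
      case 0
      then show ?case using stages_complete[OF g zs] by (simp add: F0)
    next
      case (Suc m)
      then obtain r where r: "?f (m # zs) = Some r" and y: "h (m # r # zs) = Some y"
        unfolding fS by (auto simp: bind_eq_Some_conv)
      have "\<forall>\<^sub>F s in sequentially. H ((m # r # zs) @ [s]) = Suc y"
        using stages_complete[OF h _ y] zs by simp
      with Suc.IH[OF r] show ?case by eventually_elim (simp add: FS)
    qed
    then show "\<forall>\<^sub>F s in sequentially. F (xs @ [s]) = Suc y" using f unfolding xs by simp
  qed
qed

text \<open>Every index passed over has a known positive value, so stopping at a known zero gives
  the true minimum. Any other stop is reported as unknown. Once the values up to the minimum are
  known, the search reaches it.\<close>

lemma stages_minim:
  assumes g: "stages (Suc k) g G"
  shows "\<exists>F. stages k (\<lambda>xs. minimize (\<lambda>n. g (n # xs))) F"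
proof -
  \<comment> \<open>Stop at the first \<open>n\<close> whose value is zero or not yet known, and at stage \<open>s\<close> at the latest.\<close>
  define T where "T ys = (if G ys - 1 = 0 then 0 else ys ! Suc k - ys ! 0)" for ys
  define N where "N ys = (LEAST n. T (n # ys) = 0)" for ys
  define F where "F ys = (if G (N ys # ys) = 0 then 0
      else if G (N ys # ys) - 1 = 0 then Suc (N ys) else 0)" for ys
  \<comment> \<open>\<open>G\<close> is at most 1 in two cases: 0 means unknown,
    \<open>Suc 0\<close> means known value zero. The truncated difference of \<open>s\<close> and
    \<open>n\<close> vanishes exactly when \<open>s\<close> is at most \<open>n\<close>.\<close>
  have T: "T (n # xs @ [s]) = 0 \<longleftrightarrow> G (n # xs @ [s]) \<le> 1 \<or> s \<le> n" if "length xs = k" for n xs s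
    using that by (auto simp: T_def nth_append)
  show ?thesis
  proof (rule exI, rule stagesI)
    have "total_rec (Suc (Suc k)) T"
      unfolding T_def
      by (intro total_rec_if total_rec_pred total_rec_zero total_rec_diff total_rec_proj
          stages_total_rec[OF g]) auto
    moreover have "\<exists>n. T (n # ys) = 0" if "length ys = Suc k" for ys
      by (rule exI[of _ "ys ! k"]) (simp add: T_def)
    ultimately have N: "total_rec (Suc k) N"
      unfolding N_def by (rule total_rec_Least)
    let ?Hs = "N # map (\<lambda>i ys. ys ! i) [0..<Suc k]"
    have "total_rec (Suc k) (\<lambda>ys. G (map (\<lambda>H. H ys) ?Hs))"
      by (rule total_rec_comp)
        (use stages_total_rec[OF g] N in \<open>auto intro!: total_rec_proj simp del: upt_Suc\<close>)
    then have "total_rec (Suc k) (\<lambda>ys. G (N ys # ys))"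
    proof (rule total_rec_cong)
      fix ys :: "nat list"
      assume "length ys = Suc k"
      then have "map ((!) ys) [0..<Suc k] = ys" by (metis map_nth)
      then show "G (map (\<lambda>H. H ys) ?Hs) = G (N ys # ys)"
        by (simp add: comp_def del: upt_Suc)
    qed
    then show "total_rec (Suc k) F"
      unfolding F_def by (intro total_rec_if total_rec_zero total_rec_pred total_rec_Suc N)
  next
    fix xs s y
    assume xs: "length xs = k" and "F (xs @ [s]) = Suc y"
    then have y: "N (xs @ [s]) = y" and Gy: "G ((y # xs) @ [s]) = Suc 0"
      by (auto simp: F_def split: if_splits)
    have "\<exists>z>0. g (m # xs) = Some z" if "m < y" for m
    proof -
      have "T (m # xs @ [s]) \<noteq> 0" using that not_less_Least unfolding y[symmetric] N_def by blast
      then have "G ((m # xs) @ [s]) = Suc (G ((m # xs) @ [s]) - 1)" "G ((m # xs) @ [s]) - 1 > 0"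
        using T[OF xs] by auto
      then show ?thesis using stages_sound[OF g] xs by (metis length_Cons)
    qed
    moreover have "g (y # xs) = Some 0" using stages_sound[OF g _ Gy] xs by simp
    ultimately show "minimize (\<lambda>n. g (n # xs)) = Some y"
      by (simp add: minimize_eq_Some_iff)
  next
    fix xs y
    assume xs: "length xs = k" and "minimize (\<lambda>n. g (n # xs)) = Some y"
    then have 0: "g (y # xs) = Some 0" and pos: "\<And>m. m < y \<Longrightarrow> \<exists>z>0. g (m # xs) = Some z"
      by (auto simp: minimize_eq_Some_iff)
    have "\<forall>\<^sub>F s in sequentially. G (m # xs @ [s]) > 1" if less: "m < y" for m
    proof -
      obtain z where z: "z > 0" "g (m # xs) = Some z" using pos[OF less] by blast
      have "\<forall>\<^sub>F s in sequentially. G ((m # xs) @ [s]) = Suc z"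
        using stages_complete[OF g _ z(2)] xs by simp
      then show ?thesis by eventually_elim (use z(1) in simp)
    qed
    then have "\<forall>\<^sub>F s in sequentially. \<forall>m\<in>{..<y}. G (m # xs @ [s]) > 1"
      by (simp add: eventually_ball_finite_distrib)
    moreover have "\<forall>\<^sub>F s in sequentially. G ((y # xs) @ [s]) = Suc 0"
      using stages_complete[OF g _ 0] xs by simp
    \<comment> \<open>Keeps the cutoff at \<open>s\<close> from ending the search before
      \<open>y\<close>.\<close>
    moreover have "\<forall>\<^sub>F s in sequentially. y \<le> s" by (rule eventually_ge_at_top)
    ultimately show "\<forall>\<^sub>F s in sequentially. F (xs @ [s]) = Suc y"
    proof eventually_elim
      case (elim s)
      have "N (xs @ [s]) = y"
        unfolding N_def
      proof (rule Least_equality)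
        show "T (y # xs @ [s]) = 0" using elim(2) by (simp add: T[OF xs])
        show "y \<le> n" if "T (n # xs @ [s]) = 0" for n
          using that elim(1,3) unfolding T[OF xs] by (metis leI le_trans less_le_not_le lessThan_iff)
      qed
      then show ?case using elim(2) by (simp add: F_def)
    qed
  qed
qed

text \<open>The basic functions are total, so their stage functions ignore the stage; the other
  cases are the closure lemmas.\<close>

lemma partrec_nat_stages: "partrec_nat k f \<Longrightarrow> \<exists>F. stages k f F"
proof (induction rule: partrec_nat.induct)
  case (zero k)
  have "stages k (\<lambda>_. Some 0) (\<lambda>_. Suc 0)"
    by (rule stagesI) (auto intro: total_rec_Suc total_rec_zero)
  then show ?case by blast
next
  case succ
  have "stages 1 (\<lambda>xs. Some (Suc (hd xs))) (\<lambda>ys. Suc (Suc (ys ! 0)))"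
    by (rule stagesI) (auto intro!: total_rec_Suc total_rec_proj simp: length_Suc_conv)
  then show ?case by blast
next
  case (proj i k)
  have "stages k (\<lambda>xs. Some (xs ! i)) (\<lambda>ys. Suc (ys ! i))"
    by (rule stagesI) (use proj in \<open>auto intro!: total_rec_Suc total_rec_proj simp: nth_append\<close>)
  then show ?case by blast
next
  case (comp hs g k)
  obtain G where "stages (length hs) g G" using comp.IH(1) by blast
  moreover obtain c where "\<And>h. h \<in> set hs \<Longrightarrow> stages k h (c h)" using comp.IH(2) by metis
  ultimately show ?case by (rule stages_comp)
next
  case (prim_rec k g h)
  then show ?case by (blast intro: stages_prim_rec)
next
  case (minim k g)
  then show ?case by (blast intro: stages_minim)
qed

section \<open>Dovetailing\<close>

lemma total_rec_dovetail:
  assumes "partrec_nat 1 f" "partrec_nat 1 e"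
    and total: "\<And>x. f [x] \<noteq> None \<or> e [x] \<noteq> None"
  obtains H where "total_rec 1 H" "\<And>x. e [x] = None \<Longrightarrow> f [x] = Some (H [x])"
proof -
  obtain F E where F: "stages 1 f F" and E: "stages 1 e E"
    using assms(1,2) partrec_nat_stages by metis
  \<comment> \<open>The stage comes first here because \<open>total_rec_Least\<close> searches over
    the head of the list; \<open>F\<close> and \<open>E\<close> expect it last. The value 0 signals
    that one of them has halted.\<close>
  define T where "T ys = (if F [ys ! 1, ys ! 0] = 0 then
      (if E [ys ! 1, ys ! 0] = 0 then Suc 0 else 0) else 0)" for ys
  define N where "N xs = (LEAST s. T (s # xs) = 0)" for xs
  \<comment> \<open>If only \<open>e\<close> has halted, \<open>F\<close> is 0 and truncation gives
    the default output 0.\<close>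
  define H where "H xs = F [xs ! 0, N xs] - 1" for xs
  have T: "T [s, x] = 0 \<longleftrightarrow> F [x, s] \<noteq> 0 \<or> E [x, s] \<noteq> 0" for s x
    by (simp add: T_def)
  have FE: "total_rec 2 F" "total_rec 2 E"
    using stages_total_rec[OF F] stages_total_rec[OF E] by (simp_all add: numeral_2_eq_2)
  have ex: "\<exists>s. T [s, x] = 0" for x
  proof -
    have "\<exists>s. F [x, s] \<noteq> 0" if y: "f [x] = Some y" for y
    proof -
      obtain s where "F ([x] @ [s]) = Suc y"
        using eventually_happens[OF stages_complete[OF F _ y]] by auto
      then have "F [x, s] \<noteq> 0" by simp
      then show ?thesis ..
    qed
    moreover have "\<exists>s. E [x, s] \<noteq> 0" if y: "e [x] = Some y" for y
    proof -
      obtain s where "E ([x] @ [s]) = Suc y"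
        using eventually_happens[OF stages_complete[OF E _ y]] by auto
      then have "E [x, s] \<noteq> 0" by simp
      then show ?thesis ..
    qed
    ultimately show ?thesis using total[of x] unfolding T by blast
  qed
  have "total_rec 2 T"
    unfolding T_def
    by (intro total_rec_if total_rec_comp2[OF FE(1)] total_rec_comp2[OF FE(2)] total_rec_zero
         total_rec_Suc total_rec_proj) auto
  then have "total_rec 1 N"
    unfolding N_def using ex
    by (intro total_rec_Least) (auto simp: numeral_2_eq_2 length_Suc_conv)
  then have "total_rec 1 H"
    unfolding H_def by (intro total_rec_pred total_rec_comp2[OF FE(1)] total_rec_proj \<open>total_rec 1 N\<close>) auto
  moreover have "f [x] = Some (H [x])" if "e [x] = None" for x
  proof -
    have "T [N [x], x] = 0" unfolding N_def by (rule LeastI_ex[OF ex])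
    \<comment> \<open>By soundness a nonzero value would make \<open>e\<close> defined at
      \<open>x\<close>. Hence it was \<open>F\<close> that stopped the search.\<close>
    moreover have "E [x, N [x]] = 0"
      using stages_sound[OF E, of "[x]" "N [x]"] that by (cases "E [x, N [x]]") auto
    ultimately have "F ([x] @ [N [x]]) = Suc (H [x])" by (simp add: T H_def)
    then show ?thesis using stages_sound[OF F] by simp
  qed
  ultimately show ?thesis by (rule that)
qed

section \<open>Transfer from numbers to strings\<close>

lemma F_REC_extension:
  assumes "f \<in> F_PR" "e \<in> F_PR" and total: "dom f \<union> dom e = UNIV"
  obtains h where "h \<in> F_REC" "\<And>w. w \<notin> dom e \<Longrightarrow> h w = f w"
proof -
  obtain f' where f': "partrec_nat 1 f'" "\<And>w. f' [word_code w] = map_option word_code (f w)"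
    using assms(1) unfolding F_PR_def by blast
  obtain e' where e': "partrec_nat 1 e'" "\<And>w. e' [word_code w] = map_option word_code (e w)"
    using assms(2) unfolding F_PR_def by blast
  have "f' [x] \<noteq> None \<or> e' [x] \<noteq> None" for x
  proof -
    \<comment> \<open>Surjectivity of \<open>word_code\<close> turns the covering of all strings
      into one of all numbers.\<close>
    obtain w where "x = word_code w" using word_code_surj by metis
    moreover have "w \<in> dom f \<union> dom e" using total by simp
    ultimately show ?thesis using f'(2) e'(2) by auto
  qed
  then obtain H where H: "total_rec 1 H" "\<And>x. e' [x] = None \<Longrightarrow> f' [x] = Some (H [x])"
    using total_rec_dovetail[OF f'(1) e'(1)] by blast
  obtain h' where h': "partrec_nat 1 h'" "\<And>x. h' [x] = Some (H [x])"
    using H(1) unfolding total_rec_def by force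
  define h where "h w = Some (inv word_code (H [word_code w]))" for w
  have inv: "word_code (inv word_code n) = n" "inv word_code (word_code w) = w" for n w
    using word_code_bij by (simp_all add: bij_is_surj surj_f_inv_f bij_is_inj)
  have "h \<in> F_REC"
    using h' by (auto simp: F_REC_def F_PR_def h_def inv)
  moreover have "h w = f w" if "w \<notin> dom e" for w
  proof -
    have "map_option word_code (f w) = Some (H [word_code w])"
      using H(2)[of "word_code w"] that f'(2)[of w] e'(2)[of w] by (simp add: domIff)
    then obtain v where "f w = Some v" "H [word_code w] = word_code v" by auto
    then show ?thesis by (simp add: h_def inv)
  qed
  ultimately show ?thesis by (rule that)
qed

theorem theorem11:
  shows "coRE \<inter> rankable F_REC = coRE \<inter> rankable F_PR"
proof
  show "coRE \<inter> rankable F_REC \<subseteq> coRE \<inter> rankable F_PR"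
    unfolding rankable_def F_REC_def by blast
  show "coRE \<inter> rankable F_PR \<subseteq> coRE \<inter> rankable F_REC"
  proof
    fix A
    assume A: "A \<in> coRE \<inter> rankable F_PR"
    then obtain e where e: "e \<in> F_PR" "- A = dom e" unfolding coRE_def RE_def by blast
    obtain f where f: "f \<in> F_PR" "ranking_function f A" using A unfolding rankable_def by blast
    have "A \<subseteq> dom f" using f(2) by (simp add: ranking_function_def)
    then have "dom f \<union> dom e = UNIV" using e(2) by blast
    then obtain h where h: "h \<in> F_REC" "\<And>w. w \<notin> dom e \<Longrightarrow> h w = f w"
      using F_REC_extension[OF f(1) e(1)] by blast
    have "h w = f w" if "w \<in> A" for w
      using h(2) e(2) that by blast
    \<comment> \<open>Ranking constrains values on \<open>A\<close> only, and there \<open>h\<close>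
      agrees with \<open>f\<close>.\<close>
    then have "ranking_function h A"
      using f(2) by (auto simp: ranking_function_def dom_def)
    then show "A \<in> coRE \<inter> rankable F_REC" using A h(1) unfolding rankable_def by blast
  qed
qed

end
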